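(* Let $(X,d,\mu)$ be a metric measure space with $\mu(X)<\infty$. Then every bounded strongly harmonic function in $X$ is constant. Moreover, if $f$ is a bounded weakly harmonic function in $X$ and $r^x_M=\infty$ for all $x\in X$, then $f$ is constant.
   Context: Standing assumptions: $\mu$ is Borel regular, $0<\mu(B)<\infty$ for every ball $B$, and $X$ is proper (closed bounded sets are compact). $A\Subset X$ means that $A$ has compact closure. A locally integrable $f:X\to\mathbb{R}$ is strongly harmonic in $X$ if $f(x)=\frac{1}{\mu(B(x,r))}\int_{B(x,r)}f\,d\mu$ for all $x\in X$, $r>0$ with $B(x,r)\Subset X$. It is weakly harmonic in $X$ if for every $x\in X$ there is a non-empty, at most countable set $\{r^x_1,r^x_2,\ldots\}$ of positive radii (admissible radii at $x$) with $B(x,r^x_i)\Subset X$ and $f(x)=\frac{1}{\mu(B(x,r^x_i))}\int_{B(x,r^x_i)}f\,d\mu$ for all $i$; $r^x_M=\sup_i r^x_i$. *)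

theory Defs
  imports "HOL-Analysis.Analysis"
begin

(* The space X is the whole type.  The sigma-algebra of M may be larger than the Borel
   one, so M can be a Borel measure, its completion, or a Borel regular outer measure
   restricted to its Caratheodory measurable sets. *)
locale metric_measure_space =
  fixes M :: "'a::metric_space measure"
  assumes borel_sets: "sets borel \<subseteq> sets M"
    and borel_regular: "A \<in> sets M \<Longrightarrow> \<exists>B \<in> sets borel. A \<subseteq> B \<and> emeasure M B = emeasure M A"
    and ball_pos: "0 < r \<Longrightarrow> 0 < emeasure M (ball x r)"
    and ball_finite: "0 < r \<Longrightarrow> emeasure M (ball x r) < \<infinity>"
    and proper: "closed (S :: 'a set) \<Longrightarrow> bounded S \<Longrightarrow> compact S"

definition locally_integrable :: "'a::metric_space measure \<Rightarrow> ('a \<Rightarrow> real) \<Rightarrow> bool" where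
  "locally_integrable M f \<longleftrightarrow> (\<forall>x. \<exists>r>0. set_integrable M (ball x r) f)"

definition ball_mean :: "'a::metric_space measure \<Rightarrow> ('a \<Rightarrow> real) \<Rightarrow> 'a \<Rightarrow> real \<Rightarrow> real" where
  "ball_mean M f x r = 1 / measure M (ball x r) * (LINT y:ball x r|M. f y)"

definition strongly_harmonic :: "'a::metric_space measure \<Rightarrow> ('a \<Rightarrow> real) \<Rightarrow> bool" where
  "strongly_harmonic M f \<longleftrightarrow> locally_integrable M f \<and>
     (\<forall>x r. 0 < r \<longrightarrow> compact (closure (ball x r)) \<longrightarrow> f x = ball_mean M f x r)"

(* The sets R x of admissible radii are part of the data, since the maximal radius
   depends on their choice; f is weakly harmonic iff some R exists. *)
definition weakly_harmonic ::
  "'a::metric_space measure \<Rightarrow> ('a \<Rightarrow> real) \<Rightarrow> ('a \<Rightarrow> real set) \<Rightarrow> bool" where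
  "weakly_harmonic M f R \<longleftrightarrow> locally_integrable M f \<and>
     (\<forall>x. R x \<noteq> {} \<and> countable (R x) \<and>
       (\<forall>r\<in>R x. 0 < r \<and> compact (closure (ball x r)) \<and> f x = ball_mean M f x r))"

definition max_radius :: "('a \<Rightarrow> real set) \<Rightarrow> 'a \<Rightarrow> ereal" where
  "max_radius R x = (SUP r\<in>R x. ereal r)"

end

theory Submission
  imports Defs
begin

text \<open>Every ball is relatively compact, so a strongly harmonic function is weakly harmonic with
  arbitrarily large admissible radii at each point. Along admissible radii tending to infinity, the
  means of a bounded function converge, by dominated convergence on a finite measure space, to its
  mean over the whole space. This limit does not depend on the centre of the balls.\<close>

context metric_measure_space
begin

lemma space_eq_UNIV: "space M = UNIV"
  using borel_sets sets.sets_into_space[of UNIV M] borel_open[OF open_UNIV] by blast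

lemma ball_in_sets [measurable]: "ball x r \<in> sets M"
  using borel_sets by (auto intro!: borel_open)

lemma compact_closure_ball: "compact (closure (ball (x::'a) r))"
  by (intro proper) auto

text \<open>Properness makes the closure of the ball compact, so finitely many of the small balls on
  which \<open>f\<close> is integrable cover it.\<close>

lemma locally_integrable_imp_set_integrable_ball:
  assumes "locally_integrable M f"
  shows "set_integrable M (ball x r) f"
proof -
  obtain s where s: "\<And>y. s y > 0" "\<And>y. set_integrable M (ball y (s y)) f"
    using assms unfolding locally_integrable_def by metis
  obtain D where D: "finite D" "closure (ball x r) \<subseteq> (\<Union>y\<in>D. ball y (s y))"
  proof (rule compactE_image[OF compact_closure_ball, of UNIV "\<lambda>y. ball y (s y)" x r])
    show "closure (ball x r) \<subseteq> (\<Union>y\<in>UNIV. ball y (s y))"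
      using s(1) centre_in_ball by blast
  qed auto
  have "set_integrable M (\<Union>y\<in>D. ball y (s y)) f"
    using D(1) s(2) by (intro set_integrable_UN) auto
  then show ?thesis
    by (rule set_integrable_subset) (use D(2) closure_subset[of "ball x r"] in auto)
qed

lemma tendsto_indicator_ball:
  assumes "filterlim r at_top sequentially"
  shows "(\<lambda>n. indicator (ball (x::'a) (r n)) y *\<^sub>R c) \<longlonglongrightarrow> (c::real)"
proof (rule tendsto_eventually)
  have "eventually (\<lambda>n. r n > dist x y) sequentially"
    using assms by (auto simp: filterlim_at_top_dense)
  then show "eventually (\<lambda>n. indicator (ball x (r n)) y *\<^sub>R c = c) sequentially"
    by eventually_elim simp
qed

text \<open>Local integrability gives measurability only after cutting off to a ball;
  \<open>f\<close> is the pointwise limit of its cut-offs to balls of radius \<open>n\<close> about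
  any fixed centre.\<close>

lemma locally_integrable_imp_measurable:
  assumes "locally_integrable M f"
  shows "f \<in> borel_measurable M"
proof (rule borel_measurable_LIMSEQ_real)
  fix x0 :: 'a
  show "(\<lambda>y. indicator (ball x0 (real n)) y *\<^sub>R f y) \<in> borel_measurable M" for n
    using locally_integrable_imp_set_integrable_ball[OF assms]
    unfolding set_integrable_def by (rule borel_measurable_integrable)
  show "(\<lambda>n. indicator (ball x0 (real n)) y *\<^sub>R f y) \<longlonglongrightarrow> f y" for y
    by (rule tendsto_indicator_ball[OF filterlim_real_sequentially])
qed

lemma tendsto_integral_ball:
  assumes fin: "emeasure M (space M) < \<infinity>"
    and f: "f \<in> borel_measurable M" and bdd: "bounded (range f)"
    and r: "filterlim r at_top sequentially"
  shows "(\<lambda>n. LINT y:ball x (r n)|M. f y :: real) \<longlonglongrightarrow> integral\<^sup>L M f"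
proof -
  interpret finite_measure M
    using fin by (intro finite_measureI) auto
  obtain B where B: "\<And>y. \<bar>f y\<bar> \<le> B"
    using bdd unfolding bounded_iff by auto
  show ?thesis
    unfolding set_lebesgue_integral_def
  proof (rule integral_dominated_convergence[where w = "\<lambda>_. B"])
    show "AE y in M. (\<lambda>n. indicator (ball x (r n)) y *\<^sub>R f y) \<longlonglongrightarrow> f y"
      by (intro AE_I2 tendsto_indicator_ball[OF r])
    \<comment> \<open>Outside the ball the integrand is 0, so the bound there needs
      \<open>0 \<le> B\<close>, which follows from
      \<open>0 \<le> \<bar>f y\<bar> \<le> B\<close>.\<close>
    show "AE y in M. norm (indicator (ball x (r n)) y *\<^sub>R f y) \<le> B" for n
      using B order_trans[OF abs_ge_zero B] by (auto simp: indicator_def)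
  qed (use f in auto)
qed

lemma tendsto_ball_mean:
  assumes fin: "emeasure M (space M) < \<infinity>"
    and f: "f \<in> borel_measurable M" and bdd: "bounded (range f)"
    and r: "filterlim r at_top sequentially"
  shows "(\<lambda>n. ball_mean M f x (r n)) \<longlonglongrightarrow> integral\<^sup>L M f / measure M (space M)"
proof -
  \<comment> \<open>The total measure is at least that of a unit ball, hence positive. Finiteness
    matters too, since \<open>measure\<close> is 0 on sets of infinite measure.\<close>
  have "emeasure M (ball x 1) \<le> emeasure M (space M)"
    by (intro emeasure_space)
  then have pos: "measure M (space M) \<noteq> 0"
    using ball_pos[of 1 x] fin by (auto simp: measure_def enn2real_eq_0_iff)
  \<comment> \<open>The denominators of the means are the integrals of the constant function 1, so
    the same limit theorem handles them.\<close>
  have "(\<lambda>n. LINT y:ball x (r n)|M. 1 :: real) \<longlonglongrightarrow> (LINT y|M. 1)"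
    by (rule tendsto_integral_ball[OF fin _ _ r]) auto
  then have "(\<lambda>n. measure M (ball x (r n))) \<longlonglongrightarrow> measure M (space M)"
    by (simp add: set_lebesgue_integral_def space_eq_UNIV)
  then show ?thesis
    unfolding ball_mean_def
    using tendsto_divide[OF tendsto_integral_ball[OF assms] _ pos] by auto
qed

text \<open>All positive radii are admissible here, but an admissible set must be countable. The
  positive integers are a countable choice that is still unbounded; \<open>Suc\<close> excludes the
  radius 0.\<close>

lemma strongly_harmonic_imp_weakly_harmonic:
  assumes "strongly_harmonic M f"
  shows "weakly_harmonic M f (\<lambda>_. range (\<lambda>n. real (Suc n)))"
  using assms compact_closure_ball
  unfolding strongly_harmonic_def weakly_harmonic_def by auto

lemma weakly_harmonic_bounded_constant:
  assumes fin: "emeasure M (space M) < \<infinity>"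
    and f: "weakly_harmonic M f R" and bdd: "bounded (range f)"
    and R: "\<And>x. max_radius R x = \<infinity>"
  shows "f constant_on UNIV"
proof -
  have meas: "f \<in> borel_measurable M"
    using f by (auto simp: weakly_harmonic_def intro: locally_integrable_imp_measurable)
  have "f x = integral\<^sup>L M f / measure M (space M)" for x
  proof -
    \<comment> \<open>An infinite supremum means that some admissible radius exceeds each
      \<open>n\<close>; choosing one for every \<open>n\<close> gives a sequence tending to
      infinity.\<close>
    have "\<exists>s\<in>R x. real n < s" for n
      using R[of x] less_SUP_iff[of "ereal (real n)" ereal "R x"]
      by (auto simp: max_radius_def)
    then obtain r where r: "\<And>n. r n \<in> R x" "\<And>n. real n < r n"
      by metis
    have "filterlim r at_top sequentially"
      by (rule filterlim_at_top_mono[OF filterlim_real_sequentially])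
        (use r(2) in \<open>simp add: less_imp_le\<close>)
    then have "(\<lambda>n. ball_mean M f x (r n)) \<longlonglongrightarrow> integral\<^sup>L M f / measure M (space M)"
      by (rule tendsto_ball_mean[OF fin meas bdd])
    \<comment> \<open>The means along admissible radii form a constant sequence, so
      \<open>f x\<close> equals their limit.\<close>
    moreover have "ball_mean M f x (r n) = f x" for n
      using f r(1) unfolding weakly_harmonic_def by metis
    ultimately show ?thesis
      by (simp add: LIMSEQ_const_iff)
  qed
  then show ?thesis
    unfolding constant_on_def by blast
qed

end

lemma max_radius_range_Suc: "max_radius (\<lambda>_. range (\<lambda>n. real (Suc n))) x = \<infinity>"
  unfolding max_radius_def
proof (rule SUP_PInfty)
  show "\<exists>s\<in>range (\<lambda>n. real (Suc n)). ereal (real n) \<le> ereal s" for n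
    by (rule bexI[of _ "real (Suc n)"]) auto
qed

theorem corollary7p1:
  fixes M :: "'a::metric_space measure"
  assumes "metric_measure_space M"
    and "emeasure M (space M) < \<infinity>"
  shows "(\<forall>f. strongly_harmonic M f \<and> bounded (range f) \<longrightarrow> f constant_on UNIV) \<and>
    (\<forall>f R. weakly_harmonic M f R \<and> bounded (range f) \<and> (\<forall>x. max_radius R x = \<infinity>)
      \<longrightarrow> f constant_on UNIV)"
proof -
  interpret metric_measure_space M
    by fact
  show ?thesis
    using weakly_harmonic_bounded_constant[OF assms(2)] max_radius_range_Suc
      strongly_harmonic_imp_weakly_harmonic by blast
qed

end
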